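(* Let $n\ge1$ and let $\pi,\tilde\pi$ be set partitions of $[n]=\{1,\dots,n\}$. Then $\pi$ and $\tilde\pi$ are complementary set partitions if and only if the corresponding $\vec{\boldsymbol 1}_n$-partitions $\Lambda_\pi$ and $\Lambda_{\tilde\pi}$ are complementary.
   Context: Partitions of $[n]$ are ordered by refinement, $\pi\vee\tilde\pi$ is the least upper bound, and $\pi,\tilde\pi$ are complementary if $\pi\vee\tilde\pi$ is the one-block partition $\mathbf 1_n$ of $[n]$. For a set partition $\pi=B_1|\cdots|B_m$ of $[n]$, the $\vec{\boldsymbol 1}_n$-partition $\Lambda_\pi=(\boldsymbol\lambda_1,\dots,\boldsymbol\lambda_m)$ is the $n\times m$ matrix with $(\boldsymbol\lambda_j)_t=1$ if $t\in B_j$ and $0$ otherwise, and $V_\pi\subseteq\mathbb R^n$ is the real span of its columns. $V_{\mathbf 1_n}$ is the line spanned by the all-ones vector. Two $\vec{\boldsymbol 1}_n$-partitions $\Lambda_\pi,\Lambda_{\tilde\pi}$ are complementary if $V_\pi\cap V_{\tilde\pi}=V_{\mathbf 1_n}$. *)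

theory Defs
  imports
    "HOL-Library.Disjoint_Sets"
    "HOL-Algebra.Lattice"
    "Jordan_Normal_Form.VS_Connect"
begin

definition partition_poset :: "nat \<Rightarrow> nat set set gorder" where
  "partition_poset n =
     \<lparr>carrier = {P. partition_on {1..n} P}, eq = (=), le = refines {1..n}\<rparr>"

definition complementary_partitions :: "nat \<Rightarrow> nat set set \<Rightarrow> nat set set \<Rightarrow> bool" where
  "complementary_partitions n P Q \<longleftrightarrow> P \<squnion>\<^bsub>partition_poset n\<^esub> Q = {{1..n}}"

text \<open>The library's join is a Hilbert choice among the least upper bounds. The lemma
  \<open>partition_poset_upper_semilattice\<close> shows that here a least upper bound always exists
  (and is unique), so that the choice is harmless.\<close>

lemma partition_poset_partial_order: "partial_order (partition_poset n)"
proof -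
  have trans: "refines A P R" if "refines A P Q" "refines A Q R" for A :: "nat set" and P Q R
    using that unfolding refines_def by (meson order_trans)
  show ?thesis
    by unfold_locales
      (simp_all add: partition_poset_def refines_refl refines_asym, erule (1) trans)
qed

lemma ex_partition_join:
  assumes P: "partition_on A P" and Q: "partition_on A Q"
  shows "\<exists>J. refines A P J \<and> refines A Q J \<and> (\<forall>K. refines A P K \<and> refines A Q K \<longrightarrow> refines A J K)"
proof -
  define rel where "rel X = {(x, y). \<exists>p\<in>X. x \<in> p \<and> y \<in> p}" for X :: "'a set set"
  define R where "R = (rel P \<union> rel Q)\<^sup>+"
  have eqv: "equiv A (rel X)" if "partition_on A X" for X
    using equiv_partition_on[OF that] by (simp add: rel_def)
  have sub: "rel P \<union> rel Q \<subseteq> A \<times> A"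
    using P Q by (auto simp: rel_def partition_on_def)
  have R: "equiv A R"
  proof (rule equivI)
    show "R \<subseteq> A \<times> A"
      unfolding R_def by (rule trancl_subset_Sigma[OF sub])
    have "refl_on A (rel P)" using eqv[OF P] by (simp add: equiv_def)
    then show "refl_on A R"
      unfolding R_def refl_on_def by auto
    have "sym (rel P \<union> rel Q)"
      by (auto simp: rel_def sym_def)
    then show "sym R"
      unfolding R_def by (rule sym_trancl)
    show "trans R"
      unfolding R_def by (rule trans_trancl)
  qed
  have J: "partition_on A (A // R)"
    by (rule partition_on_quotient[OF R])
  have up: "refines A X (A // R)" if X: "partition_on A X" and XR: "rel X \<subseteq> R" for X
    unfolding refines_def
  proof (intro conjI ballI X J)
    fix p assume p: "p \<in> X"
    then obtain x where x: "x \<in> p"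
      using X by (metis all_not_in_conv partition_onD3)
    have "x \<in> A"
      using p x X by (auto simp: partition_on_def)
    moreover have "p \<subseteq> R `` {x}"
      using p x XR by (auto simp: rel_def)
    ultimately show "\<exists>q\<in>A // R. p \<subseteq> q"
      by (meson quotientI)
  qed
  have "refines A (A // R) K" if K: "refines A P K" "refines A Q K" for K
    unfolding refines_def
  proof (intro conjI ballI J)
    show pK: "partition_on A K" using K by (simp add: refines_def)
    have "rel X \<subseteq> rel K" if XK: "refines A X K" for X
      unfolding rel_def
    proof clarify
      fix x y p assume "p \<in> X" "x \<in> p" "y \<in> p"
      moreover from \<open>p \<in> X\<close> obtain k where "k \<in> K" "p \<subseteq> k"
        using XK unfolding refines_def by metis
      ultimately show "\<exists>k\<in>K. x \<in> k \<and> y \<in> k" by auto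
    qed
    then have "rel P \<union> rel Q \<subseteq> rel K"
      using K by (simp only: Un_subset_iff)
    then have "R \<subseteq> (rel K)\<^sup>+"
      unfolding R_def by (rule trancl_mono_subset)
    moreover have "(rel K)\<^sup>+ = rel K"
      using eqv[OF pK] by (intro trancl_id) (simp add: equiv_def)
    ultimately have RK: "R \<subseteq> rel K"
      by simp
    fix b assume "b \<in> A // R"
    then obtain x where x: "x \<in> A" "b = R `` {x}" by (rule quotientE)
    then obtain k where k: "k \<in> K" "x \<in> k" using pK by (auto simp: partition_on_def)
    have "b \<subseteq> k"
    proof
      fix y assume "y \<in> b"
      then obtain k' where k': "k' \<in> K" "x \<in> k'" "y \<in> k'"
        using RK x by (auto simp: rel_def)
      then have "k' = k"
        using partition_onD2[OF pK] k by (auto simp: disjoint_def)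
      then show "y \<in> k" using k' by simp
    qed
    then show "\<exists>k\<in>K. b \<subseteq> k" using k by blast
  qed
  moreover have "rel P \<subseteq> R" "rel Q \<subseteq> R" by (auto simp: R_def)
  ultimately show ?thesis using up[OF P] up[OF Q] by blast
qed

lemma partition_poset_upper_semilattice: "upper_semilattice (partition_poset n)"
proof -
  interpret partial_order "partition_poset n" by (rule partition_poset_partial_order)
  show ?thesis
  proof unfold_locales
    fix P Q assume "P \<in> carrier (partition_poset n)" "Q \<in> carrier (partition_poset n)"
    then have PQ: "partition_on {1..n} P" "partition_on {1..n} Q"
      by (auto simp: partition_poset_def)
    obtain J where "refines {1..n} P J" "refines {1..n} Q J"
      "\<forall>K. refines {1..n} P K \<and> refines {1..n} Q K \<longrightarrow> refines {1..n} J K"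
      using ex_partition_join[OF PQ] by blast
    moreover have "carrier (partition_poset n) = {P. partition_on {1..n} P}"
      and "le (partition_poset n) = refines {1..n}"
      by (simp_all add: partition_poset_def)
    moreover have "partition_on {1..n} J"
      using \<open>refines {1..n} P J\<close> by (simp add: refines_def)
    ultimately have "least (partition_poset n) J (Upper (partition_poset n) {P, Q})"
      using PQ by (simp add: least_def Upper_def)
    then show "\<exists>J. least (partition_poset n) J (Upper (partition_poset n) {P, Q})" ..
  qed
qed

text \<open>A partition is passed as the list of its blocks \<open>B\<^sub>1, \<dots>, B\<^sub>m\<close>, which fixes the order of the
  columns. Matrix rows are numbered from \<open>0\<close>, so row \<open>t\<close> belongs to the element \<open>Suc t\<close> of
  \<open>{1..n}\<close>.\<close>

definition partition_mat :: "nat \<Rightarrow> nat set list \<Rightarrow> real mat" where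
  "partition_mat n Bs = mat n (length Bs) (\<lambda>(t, j). if Suc t \<in> Bs ! j then 1 else 0)"

definition complementary_mats :: "nat \<Rightarrow> real mat \<Rightarrow> real mat \<Rightarrow> bool" where
  "complementary_mats n L M \<longleftrightarrow>
     vec_space.col_space n L \<inter> vec_space.col_space n M =
     vec_space.col_space n (partition_mat n [{1..n}])"

end

(* The column space of the matrix of a partition consists of the vectors that are constant on every
   block. Such vectors are functions whose level-set partition is refined by the given one, so a
   function is constant on the blocks of both P and Q exactly when it is constant on the blocks of
   their join. The join has a single block iff the only such functions are the constants: for a
   join with several blocks, the indicator function of one of them is a counterexample. *)

theory Submission
  imports Defs
begin

text \<open>Phrased for functions on the ground set rather than for vectors, so that the argument
  about joins stays free of matrices and index shifts.\<close>

definition blockwise_constant :: "('a \<Rightarrow> 'b) \<Rightarrow> 'a set set \<Rightarrow> bool" where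
  "blockwise_constant f P \<longleftrightarrow> (\<forall>B\<in>P. \<forall>x\<in>B. \<forall>y\<in>B. f x = f y)"

lemma partition_on_level_sets: "partition_on A ((\<lambda>x. {y\<in>A. f y = f x}) ` A)"
  by (rule partition_onI) (auto simp: disjnt_def)

text \<open>A block on which \<open>f\<close> is constant lies in the level set of any of its
  points. The level-set partition thus becomes an upper bound to test the join against.\<close>

lemma refines_level_sets:
  assumes P: "partition_on A P" and f: "blockwise_constant f P"
  shows "refines A P ((\<lambda>x. {y\<in>A. f y = f x}) ` A)"
  unfolding refines_def
proof (intro conjI ballI P partition_on_level_sets)
  fix B assume B: "B \<in> P"
  then obtain x where x: "x \<in> B"
    using partition_onD3[OF P] by (metis all_not_in_conv)
  have "B \<subseteq> A"
    using P B by (auto simp: partition_on_def)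
  moreover have "B \<subseteq> {y\<in>A. f y = f x}"
    using \<open>B \<subseteq> A\<close> f B x unfolding blockwise_constant_def by blast
  ultimately show "\<exists>Y\<in>(\<lambda>x. {y\<in>A. f y = f x}) ` A. B \<subseteq> Y"
    using x by blast
qed

lemma blockwise_constant_refines:
  assumes "refines A P J" "blockwise_constant f J"
  shows "blockwise_constant f P"
  unfolding blockwise_constant_def
proof (intro ballI)
  fix B x y assume "B \<in> P" "x \<in> B" "y \<in> B"
  then obtain C where "C \<in> J" "x \<in> C" "y \<in> C"
    using assms(1) unfolding refines_def by blast
  then show "f x = f y"
    using assms(2) unfolding blockwise_constant_def by blast
qed

text \<open>By disjointness every block either is \<open>B\<close> or misses \<open>B\<close>. This
  supplies the function that separates one block from the rest.\<close>

lemma blockwise_constant_indicator: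
  assumes "partition_on A P" "B \<in> P"
  shows "blockwise_constant (\<lambda>x. of_bool (x \<in> B)) P"
  unfolding blockwise_constant_def
proof (intro ballI)
  fix C x y assume "C \<in> P" "x \<in> C" "y \<in> C"
  then have "x \<in> B \<longleftrightarrow> y \<in> B"
    using disjointD[OF partition_onD2[OF assms(1)] \<open>C \<in> P\<close> assms(2)] by blast
  then show "of_bool (x \<in> B) = of_bool (y \<in> B)"
    by simp
qed

lemma partition_poset_join:
  assumes "partition_on {1..n} P" "partition_on {1..n} Q"
  shows "refines {1..n} P (P \<squnion>\<^bsub>partition_poset n\<^esub> Q)"
    and "refines {1..n} Q (P \<squnion>\<^bsub>partition_poset n\<^esub> Q)"
    and "refines {1..n} P K \<Longrightarrow> refines {1..n} Q K \<Longrightarrow>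
      refines {1..n} (P \<squnion>\<^bsub>partition_poset n\<^esub> Q) K"
proof -
  interpret upper_semilattice "partition_poset n"
    by (rule partition_poset_upper_semilattice)
  have carrier: "carrier (partition_poset n) = {P. partition_on {1..n} P}"
    and le: "le (partition_poset n) = refines {1..n}"
    by (simp_all add: partition_poset_def)
  show "refines {1..n} P (P \<squnion>\<^bsub>partition_poset n\<^esub> Q)"
    using join_left[of P Q] assms by (simp add: carrier le)
  show "refines {1..n} Q (P \<squnion>\<^bsub>partition_poset n\<^esub> Q)"
    using join_right[of P Q] assms by (simp add: carrier le)
  show "refines {1..n} (P \<squnion>\<^bsub>partition_poset n\<^esub> Q) K"
    if "refines {1..n} P K" "refines {1..n} Q K"
  proof -
    have "partition_on {1..n} K"
      using that by (simp add: refines_def)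
    then show ?thesis
      using join_le[of P K Q] that assms by (simp add: carrier le)
  qed
qed

text \<open>Constancy passes from the join down to the finer \<open>P\<close> and \<open>Q\<close>.
  Conversely, the level sets of \<open>f\<close> form a common upper bound of \<open>P\<close> and
  \<open>Q\<close>, hence lie above the join, and \<open>f\<close> is constant on them by
  construction.\<close>

lemma blockwise_constant_join_iff:
  assumes "partition_on {1..n} P" "partition_on {1..n} Q"
  shows "blockwise_constant f (P \<squnion>\<^bsub>partition_poset n\<^esub> Q) \<longleftrightarrow>
    blockwise_constant f P \<and> blockwise_constant f Q"
proof
  assume "blockwise_constant f (P \<squnion>\<^bsub>partition_poset n\<^esub> Q)"
  then show "blockwise_constant f P \<and> blockwise_constant f Q"
    using partition_poset_join(1,2)[OF assms] blockwise_constant_refines by blast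
next
  let ?K = "(\<lambda>x. {y\<in>{1..n}. f y = f x}) ` {1..n}"
  assume "blockwise_constant f P \<and> blockwise_constant f Q"
  then have "refines {1..n} (P \<squnion>\<^bsub>partition_poset n\<^esub> Q) ?K"
    using partition_poset_join(3)[OF assms] refines_level_sets assms by blast
  moreover have "blockwise_constant f ?K"
    by (auto simp: blockwise_constant_def)
  ultimately show "blockwise_constant f (P \<squnion>\<^bsub>partition_poset n\<^esub> Q)"
    by (rule blockwise_constant_refines)
qed

text \<open>If the indicator of a nonempty block \<open>B\<close> is constant on \<open>A\<close>,
  then \<open>B = A\<close>. Nonemptiness of \<open>A\<close> rules out the empty partition.\<close>

lemma partition_eq_one_block_iff:
  assumes J: "partition_on A J" and "A \<noteq> {}"
  shows "J = {A} \<longleftrightarrow> (\<forall>f :: 'a \<Rightarrow> real. blockwise_constant f J \<longrightarrow> blockwise_constant f {A})"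
proof
  assume const: "\<forall>f :: 'a \<Rightarrow> real. blockwise_constant f J \<longrightarrow> blockwise_constant f {A}"
  have "B = A" if B: "B \<in> J" for B
  proof -
    have "B \<subseteq> A" "B \<noteq> {}"
      using J B by (auto simp: partition_on_def)
    moreover have "blockwise_constant (\<lambda>x. of_bool (x \<in> B) :: real) {A}"
      using const blockwise_constant_indicator[OF J B] by blast
    then have "\<forall>x\<in>A. \<forall>y\<in>A. x \<in> B \<longleftrightarrow> y \<in> B"
      unfolding blockwise_constant_def of_bool_eq_iff by blast
    ultimately show "B = A" by blast
  qed
  moreover have "J \<noteq> {}"
    using J \<open>A \<noteq> {}\<close> by (auto simp: partition_on_def)
  ultimately show "J = {A}" by blast
qed simp

text \<open>Row \<open>t\<close> has a single entry 1, in the column of the block containing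
  \<open>Suc t\<close>, so the product reads off that one coefficient.\<close>

lemma partition_mat_mult_vec_index:
  assumes P: "partition_on {1..n} (set Bs)" and "distinct Bs"
    and x: "x \<in> carrier_vec (length Bs)"
    and j: "j < length Bs" and t: "Suc t \<in> Bs ! j"
  shows "t < n" and "(partition_mat n Bs *\<^sub>v x) $ t = x $ j"
proof -
  have "Suc t \<in> {1..n}"
    using partition_onD1[OF P] nth_mem[OF j] t by blast
  then show tn: "t < n" by simp
  \<comment> \<open>Disjointness makes the blocks equal; distinctness of the list then makes their
    indices equal.\<close>
  have "Suc t \<in> Bs ! i \<longleftrightarrow> i = j" if "i < length Bs" for i
    using disjointD[OF partition_onD2[OF P] nth_mem[OF that] nth_mem[OF j]] t
      nth_eq_iff_index_eq[OF \<open>distinct Bs\<close> that j] by auto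
  then have "(partition_mat n Bs *\<^sub>v x) $ t = (\<Sum>i\<in>{0..<length Bs}. (if i = j then 1 else 0) * x $ i)"
    using x tn by (simp add: partition_mat_def scalar_prod_def)
  also have "\<dots> = (\<Sum>i\<in>{0..<length Bs}. if i = j then x $ i else 0)"
    by (rule sum.cong) auto
  also have "\<dots> = x $ j"
    using j by simp
  finally show "(partition_mat n Bs *\<^sub>v x) $ t = x $ j" .
qed

text \<open>The coefficient of a column is the common value of \<open>f\<close> on the corresponding
  block.\<close>

lemma mem_col_space_partition_mat_iff:
  fixes f :: "nat \<Rightarrow> real"
  assumes P: "partition_on {1..n} (set Bs)" and dist: "distinct Bs"
  shows "vec n (\<lambda>t. f (Suc t)) \<in> vec_space.col_space n (partition_mat n Bs) \<longleftrightarrow>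
    blockwise_constant f (set Bs)"
proof -
  have mat: "partition_mat n Bs \<in> carrier_mat n (length Bs)"
    by (simp add: partition_mat_def)
  have "vec n (\<lambda>t. f (Suc t)) \<in> vec_space.col_space n (partition_mat n Bs) \<longleftrightarrow>
      (\<exists>x\<in>carrier_vec (length Bs). partition_mat n Bs *\<^sub>v x = vec n (\<lambda>t. f (Suc t)))"
    unfolding vec_space.col_space_eq[OF mat] using mat by auto
  also have "\<dots> \<longleftrightarrow> blockwise_constant f (set Bs)"
  proof
    assume "\<exists>x\<in>carrier_vec (length Bs). partition_mat n Bs *\<^sub>v x = vec n (\<lambda>t. f (Suc t))"
    then obtain x where x: "x \<in> carrier_vec (length Bs)"
      and eq: "partition_mat n Bs *\<^sub>v x = vec n (\<lambda>t. f (Suc t))" by blast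
    have "f s = x $ j" if j: "j < length Bs" and s: "s \<in> Bs ! j" for j s
    proof -
      have "s \<in> {1..n}"
        using partition_onD1[OF P] nth_mem[OF j] s by blast
      then obtain t where t: "s = Suc t"
        by (cases s) auto
      show ?thesis
        using partition_mat_mult_vec_index[OF P dist x j s[unfolded t]] by (simp add: eq t)
    qed
    then show "blockwise_constant f (set Bs)"
      unfolding blockwise_constant_def by (metis in_set_conv_nth)
  next
    assume f: "blockwise_constant f (set Bs)"
    \<comment> \<open>Any representative of the block serves, since \<open>f\<close> is constant on
      it.\<close>
    define x where "x = vec (length Bs) (\<lambda>j. f (SOME s. s \<in> Bs ! j))"
    have x: "x \<in> carrier_vec (length Bs)" by (simp add: x_def)
    have "partition_mat n Bs *\<^sub>v x = vec n (\<lambda>t. f (Suc t))"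
    proof (rule eq_vecI)
      fix t assume "t < dim_vec (vec n (\<lambda>t. f (Suc t)))"
      then have "Suc t \<in> \<Union>(set Bs)"
        using partition_onD1[OF P] by auto
      then obtain j where j: "j < length Bs" "Suc t \<in> Bs ! j"
        by (auto simp: in_set_conv_nth)
      have "f (SOME s. s \<in> Bs ! j) = f (Suc t)"
        using f nth_mem[OF j(1)] j(2) someI[of "\<lambda>s. s \<in> Bs ! j", OF j(2)]
        unfolding blockwise_constant_def by blast
      then show "(partition_mat n Bs *\<^sub>v x) $ t = vec n (\<lambda>t. f (Suc t)) $ t"
        using partition_mat_mult_vec_index[OF P dist x j] j(1) by (simp add: x_def)
    qed (use mat in simp)
    then show "\<exists>x\<in>carrier_vec (length Bs). partition_mat n Bs *\<^sub>v x = vec n (\<lambda>t. f (Suc t))"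
      using x by blast
  qed
  finally show ?thesis .
qed

lemma col_space_partition_mat:
  assumes "partition_on {1..n} (set Bs)" "distinct Bs"
  shows "vec_space.col_space n (partition_mat n Bs) =
    {vec n (\<lambda>t. f (Suc t)) | f. blockwise_constant f (set Bs)}"
proof -
  have mat: "partition_mat n Bs \<in> carrier_mat n (length Bs)"
    by (simp add: partition_mat_def)
  have "\<exists>f. v = vec n (\<lambda>t. f (Suc t))"
    if "v \<in> vec_space.col_space n (partition_mat n Bs)" for v
  proof -
    have "v \<in> carrier_vec n"
      using that mat unfolding vec_space.col_space_eq[OF mat] by auto
    \<comment> \<open>The witness undoes the shift between coordinates and elements; its value at 0
      is never read.\<close>
    then show ?thesis
      by (intro exI[of _ "\<lambda>s. v $ (s - 1)"] eq_vecI) auto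
  qed
  then show ?thesis
    using mem_col_space_partition_mat_iff[OF assms] by blast
qed

theorem corollary4p1:
  fixes n :: nat and P Q :: "nat set set" and Bs Cs :: "nat set list"
  assumes "n \<ge> 1"
    and "partition_on {1..n} P" and "partition_on {1..n} Q"
    and "distinct Bs" and "set Bs = P"
    and "distinct Cs" and "set Cs = Q"
  shows "complementary_partitions n P Q \<longleftrightarrow>
         complementary_mats n (partition_mat n Bs) (partition_mat n Cs)"
proof -
  let ?J = "P \<squnion>\<^bsub>partition_poset n\<^esub> Q"
  let ?v = "\<lambda>f :: nat \<Rightarrow> real. vec n (\<lambda>t. f (Suc t))"
  let ?V = "\<lambda>Bs. vec_space.col_space n (partition_mat n Bs)"
  have one: "partition_on {1..n} (set [{1..n}])"
    using \<open>n \<ge> 1\<close> by (auto intro!: partition_onI)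
  have V: "partition_on {1..n} (set Bs)" "partition_on {1..n} (set Cs)"
    using assms by simp_all
  have mem: "?v f \<in> ?V Bs \<longleftrightarrow> blockwise_constant f P"
    "?v f \<in> ?V Cs \<longleftrightarrow> blockwise_constant f Q"
    "?v f \<in> ?V [{1..n}] \<longleftrightarrow> blockwise_constant f {{1..n}}" for f
    using mem_col_space_partition_mat_iff[OF V(1)] mem_col_space_partition_mat_iff[OF V(2)]
      mem_col_space_partition_mat_iff[OF one] assms by simp_all
  have const: "blockwise_constant f {{1..n}} \<Longrightarrow> blockwise_constant f X"
    if "partition_on {1..n} X" for f :: "nat \<Rightarrow> real" and X
  proof (rule blockwise_constant_refines)
    show "refines {1..n} X {{1..n}}"
      using that one by (auto simp: refines_def partition_on_def)
  qed
  have "partition_on {1..n} ?J"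
    using partition_poset_join(1)[OF assms(2,3)] by (simp add: refines_def)
  then have "complementary_partitions n P Q \<longleftrightarrow>
      (\<forall>f :: nat \<Rightarrow> real. blockwise_constant f ?J \<longrightarrow> blockwise_constant f {{1..n}})"
    unfolding complementary_partitions_def
    by (rule partition_eq_one_block_iff) (use \<open>n \<ge> 1\<close> in simp)
  \<comment> \<open>By \<open>const\<close>, one direction of the equivalence on the right is
    automatic; the other is the implication on the left.\<close>
  also have "\<dots> \<longleftrightarrow> (\<forall>f. ?v f \<in> ?V Bs \<inter> ?V Cs \<longleftrightarrow> ?v f \<in> ?V [{1..n}])"
    using const[OF assms(2)] const[OF assms(3)]
    unfolding blockwise_constant_join_iff[OF assms(2,3)] Int_iff mem by blast
  also have "\<dots> \<longleftrightarrow> ?V Bs \<inter> ?V Cs = ?V [{1..n}]"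
  \<comment> \<open>Both sides contain only vectors of the form \<open>?v f\<close>, so agreement on
    these gives equality of the spaces.\<close>
  proof
    assume eq: "\<forall>f. ?v f \<in> ?V Bs \<inter> ?V Cs \<longleftrightarrow> ?v f \<in> ?V [{1..n}]"
    have "\<exists>f. v = ?v f" if "v \<in> ?V Bs \<or> v \<in> ?V [{1..n}]" for v
      using that col_space_partition_mat[OF V(1) \<open>distinct Bs\<close>] col_space_partition_mat[OF one]
      by auto
    then show "?V Bs \<inter> ?V Cs = ?V [{1..n}]"
      using eq by blast
  qed blast
  finally show ?thesis
    by (simp add: complementary_mats_def)
qed

end
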